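(* Suppose the standing assumptions on $\mathbb{T},p^\tau,P,\phi_{tsa}$ listed in the context hold. Suppose $\{y^\tau\}_{\tau\in\mathbb{T}}$ is an optimal solution of the optimization problem (P) of the context and $(u,\{v^\tau\}_{\tau\in\mathbb{T}})$ is an optimal solution of the optimization problem (D) of the context. Then for every $\tau\in\mathbb{T}$, $s\in[S]$, $a\in[A]$: if $y^\tau_{\tau sa}>0$, then $$v^\tau_{\tau s}=\min_{a'\in[A]}\phi_{\tau sa'}\Big(\sum_{j\in\mathbb{T},\,j\ge\tau}y^j_{\tau sa'}\Big)\quad\text{and } a\text{ attains this minimum};$$ and for every $t\in[\tau-1]$, if $y^\tau_{tsa}>0$, then $$v^\tau_{ts}=\min_{a'\in[A]}\Big(\phi_{tsa'}\Big(\sum_{j\in\mathbb{T},\,j\ge t}y^j_{tsa'}\Big)+\sum_{s'\in[S]}P_{sa's'}v^\tau_{t+1,s'}\Big)\quad\text{and } a\text{ attains this minimum}.$$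
   Context: For a positive integer $N$, $[N]=\{1,\dots,N\}$ (and $[0]=\emptyset$). $T,S,A$ are positive integers (numbers of time steps, states, actions). $\sum_{t,s,a}$ ranges over $t\in[T],s\in[S],a\in[A]$, etc. $\mathbb{T}$ is the set of ending times; sums over $\tau$ are over $\tau\in\mathbb{T}$. Standing assumptions: $T\in\mathbb{T}\subseteq[T]$; $p^\tau_{ts}\in\mathbb{R}_+$ (nonnegative) for all $\tau\in\mathbb{T}$, $t\le\tau$, $s\in[S]$; $P\in\mathbb{R}_+^{S\times A\times S}$ with $\sum_{s'}P_{sas'}=1$ for all $s\in[S],a\in[A]$. Let $\rho=\sum_{\tau\in\mathbb{T}}\sum_{t\le\tau,\,s}p^\tau_{ts}$. For all $t\in[T],s\in[S],a\in[A]$ the function $\phi_{tsa}:[0,\rho]\to\mathbb{R}$ is continuous and strictly increasing. Problem (P): over $y^\tau\in\mathbb{R}^{\tau\times S\times A}$, $\tau\in\mathbb{T}$, minimize $$\sum_{t,s,a}\int_0^{\sum_{\tau\ge t}y^\tau_{tsa}}\phi_{tsa}(\alpha)\,d\alpha$$ subject to, for all $\tau\in\mathbb{T}$, $s\in[S]$: $\sum_a y^\tau_{1sa}=p^\tau_{1s}$; $\sum_a y^\tau_{t+1,sa}=p^\tau_{t+1,s}+\sum_{s',a}P_{s'as}y^\tau_{ts'a}$ for $t\in[\tau-1]$; and $y^\tau_{tsa}\ge0$ for all $t\in[\tau]$, $a\in[A]$. Problem (D): over $u\in\mathbb{R}^{T\times S\times A}$ and $v^\tau\in\mathbb{R}^{\tau\times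 S}$, $\tau\in\mathbb{T}$, maximize $$\sum_{t,s}\sum_{\tau\ge t}p^\tau_{ts}v^\tau_{ts}-\sum_{t,s,a}\int_{\phi_{tsa}(0)}^{u_{tsa}}\phi_{tsa}^{-1}(\alpha)\,d\alpha$$ subject to, for all $\tau\in\mathbb{T}$, $s\in[S]$, $a\in[A]$: $v^\tau_{\tau s}\le u_{\tau sa}$; $v^\tau_{ts}\le u_{tsa}+\sum_{s'}P_{sas'}v^\tau_{t+1,s'}$ for $t\in[\tau-1]$. Here $u_{tsa}$ ranges over the domain of the inverse function, i.e. $u_{tsa}\in[\phi_{tsa}(0),\phi_{tsa}(\rho)]$. *)

theory Defs
  imports "HOL-Analysis.Analysis"
begin

text \<open>
  Time steps, states and actions are the natural numbers in \<open>{1..T}\<close>, \<open>{1..S}\<close>, \<open>{1..A}\<close>.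
  Families are total functions whose values outside their index range are never inspected:
  \<open>p \<tau> t s\<close>, \<open>v \<tau> t s\<close>, \<open>y \<tau> t s a\<close> are meant for \<open>\<tau> \<in> TT\<close>, \<open>t \<in> {1..\<tau>}\<close>; \<open>P s a s'\<close> is the
  probability of moving from \<open>s\<close> to \<open>s'\<close> under action \<open>a\<close>; and \<open>\<phi> t s a\<close> matters only on \<open>{0..\<rho>}\<close>.
\<close>

definition total_mass :: "nat \<Rightarrow> nat set \<Rightarrow> (nat \<Rightarrow> nat \<Rightarrow> nat \<Rightarrow> real) \<Rightarrow> real" where
  "total_mass S TT p = (\<Sum>\<tau>\<in>TT. \<Sum>t=1..\<tau>. \<Sum>s=1..S. p \<tau> t s)"

definition standing_assumptions ::
  "nat \<Rightarrow> nat \<Rightarrow> nat \<Rightarrow> nat set \<Rightarrow> (nat \<Rightarrow> nat \<Rightarrow> nat \<Rightarrow> real) \<Rightarrow> (nat \<Rightarrow> nat \<Rightarrow> nat \<Rightarrow> real)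
    \<Rightarrow> (nat \<Rightarrow> nat \<Rightarrow> nat \<Rightarrow> real \<Rightarrow> real) \<Rightarrow> bool" where
  "standing_assumptions T S A TT p P \<phi> \<longleftrightarrow>
     1 \<le> T \<and> 1 \<le> S \<and> 1 \<le> A \<and>
     T \<in> TT \<and> TT \<subseteq> {1..T} \<and>
     (\<forall>\<tau>\<in>TT. \<forall>t\<in>{1..\<tau>}. \<forall>s\<in>{1..S}. 0 \<le> p \<tau> t s) \<and>
     (\<forall>s\<in>{1..S}. \<forall>a\<in>{1..A}. \<forall>s'\<in>{1..S}. 0 \<le> P s a s') \<and>
     (\<forall>s\<in>{1..S}. \<forall>a\<in>{1..A}. (\<Sum>s'=1..S. P s a s') = 1) \<and>
     (\<forall>t\<in>{1..T}. \<forall>s\<in>{1..S}. \<forall>a\<in>{1..A}.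
        continuous_on {0..total_mass S TT p} (\<phi> t s a) \<and>
        strict_mono_on {0..total_mass S TT p} (\<phi> t s a))"

definition aggregate ::
  "nat set \<Rightarrow> (nat \<Rightarrow> nat \<Rightarrow> nat \<Rightarrow> nat \<Rightarrow> real) \<Rightarrow> nat \<Rightarrow> nat \<Rightarrow> nat \<Rightarrow> real" where
  "aggregate TT y t s a = (\<Sum>\<tau>\<in>{\<tau>\<in>TT. t \<le> \<tau>}. y \<tau> t s a)"

definition primal_feasible ::
  "nat \<Rightarrow> nat \<Rightarrow> nat set \<Rightarrow> (nat \<Rightarrow> nat \<Rightarrow> nat \<Rightarrow> real) \<Rightarrow> (nat \<Rightarrow> nat \<Rightarrow> nat \<Rightarrow> real)
    \<Rightarrow> (nat \<Rightarrow> nat \<Rightarrow> nat \<Rightarrow> nat \<Rightarrow> real) \<Rightarrow> bool" where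
  "primal_feasible S A TT p P y \<longleftrightarrow>
     (\<forall>\<tau>\<in>TT. \<forall>s\<in>{1..S}.
        (\<Sum>a=1..A. y \<tau> 1 s a) = p \<tau> 1 s \<and>
        (\<forall>t\<in>{1..<\<tau>}. (\<Sum>a=1..A. y \<tau> (t + 1) s a)
           = p \<tau> (t + 1) s + (\<Sum>s'=1..S. \<Sum>a=1..A. P s' a s * y \<tau> t s' a)) \<and>
        (\<forall>t\<in>{1..\<tau>}. \<forall>a\<in>{1..A}. 0 \<le> y \<tau> t s a))"

text \<open>
  The unoriented integrals in the two objectives agree with the oriented ones at every feasible
  point: there the aggregates lie in \<open>{0..\<rho>}\<close>, and \<open>u t s a\<close> lies in \<open>{\<phi> t s a 0..\<phi> t s a \<rho>}\<close>.
\<close>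

definition primal_objective ::
  "nat \<Rightarrow> nat \<Rightarrow> nat \<Rightarrow> nat set \<Rightarrow> (nat \<Rightarrow> nat \<Rightarrow> nat \<Rightarrow> real \<Rightarrow> real)
    \<Rightarrow> (nat \<Rightarrow> nat \<Rightarrow> nat \<Rightarrow> nat \<Rightarrow> real) \<Rightarrow> real" where
  "primal_objective T S A TT \<phi> y =
     (\<Sum>t=1..T. \<Sum>s=1..S. \<Sum>a=1..A. integral {0..aggregate TT y t s a} (\<phi> t s a))"

definition primal_optimal ::
  "nat \<Rightarrow> nat \<Rightarrow> nat \<Rightarrow> nat set \<Rightarrow> (nat \<Rightarrow> nat \<Rightarrow> nat \<Rightarrow> real) \<Rightarrow> (nat \<Rightarrow> nat \<Rightarrow> nat \<Rightarrow> real)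
    \<Rightarrow> (nat \<Rightarrow> nat \<Rightarrow> nat \<Rightarrow> real \<Rightarrow> real) \<Rightarrow> (nat \<Rightarrow> nat \<Rightarrow> nat \<Rightarrow> nat \<Rightarrow> real) \<Rightarrow> bool" where
  "primal_optimal T S A TT p P \<phi> y \<longleftrightarrow>
     is_arg_min (primal_objective T S A TT \<phi>) (primal_feasible S A TT p P) y"

text \<open>The bounds on \<open>u\<close> say that \<open>u t s a\<close> lies in the domain of the inverse of \<open>\<phi> t s a\<close>.\<close>

definition dual_feasible ::
  "nat \<Rightarrow> nat \<Rightarrow> nat \<Rightarrow> nat set \<Rightarrow> (nat \<Rightarrow> nat \<Rightarrow> nat \<Rightarrow> real) \<Rightarrow> (nat \<Rightarrow> nat \<Rightarrow> nat \<Rightarrow> real)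
    \<Rightarrow> (nat \<Rightarrow> nat \<Rightarrow> nat \<Rightarrow> real \<Rightarrow> real)
    \<Rightarrow> (nat \<Rightarrow> nat \<Rightarrow> nat \<Rightarrow> real) \<Rightarrow> (nat \<Rightarrow> nat \<Rightarrow> nat \<Rightarrow> real) \<Rightarrow> bool" where
  "dual_feasible T S A TT p P \<phi> u v \<longleftrightarrow>
     (\<forall>t\<in>{1..T}. \<forall>s\<in>{1..S}. \<forall>a\<in>{1..A}.
        u t s a \<in> {\<phi> t s a 0..\<phi> t s a (total_mass S TT p)}) \<and>
     (\<forall>\<tau>\<in>TT. \<forall>s\<in>{1..S}. \<forall>a\<in>{1..A}.
        v \<tau> \<tau> s \<le> u \<tau> s a \<and>
        (\<forall>t\<in>{1..<\<tau>}. v \<tau> t s \<le> u t s a + (\<Sum>s'=1..S. P s a s' * v \<tau> (t + 1) s')))"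

definition dual_objective ::
  "nat \<Rightarrow> nat \<Rightarrow> nat \<Rightarrow> nat set \<Rightarrow> (nat \<Rightarrow> nat \<Rightarrow> nat \<Rightarrow> real)
    \<Rightarrow> (nat \<Rightarrow> nat \<Rightarrow> nat \<Rightarrow> real \<Rightarrow> real)
    \<Rightarrow> (nat \<Rightarrow> nat \<Rightarrow> nat \<Rightarrow> real) \<Rightarrow> (nat \<Rightarrow> nat \<Rightarrow> nat \<Rightarrow> real) \<Rightarrow> real" where
  "dual_objective T S A TT p \<phi> u v =
     (\<Sum>t=1..T. \<Sum>s=1..S. \<Sum>\<tau>\<in>{\<tau>\<in>TT. t \<le> \<tau>}. p \<tau> t s * v \<tau> t s)
     - (\<Sum>t=1..T. \<Sum>s=1..S. \<Sum>a=1..A.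
          integral {\<phi> t s a 0..u t s a} (inv_into {0..total_mass S TT p} (\<phi> t s a)))"

definition dual_optimal ::
  "nat \<Rightarrow> nat \<Rightarrow> nat \<Rightarrow> nat set \<Rightarrow> (nat \<Rightarrow> nat \<Rightarrow> nat \<Rightarrow> real) \<Rightarrow> (nat \<Rightarrow> nat \<Rightarrow> nat \<Rightarrow> real)
    \<Rightarrow> (nat \<Rightarrow> nat \<Rightarrow> nat \<Rightarrow> real \<Rightarrow> real)
    \<Rightarrow> (nat \<Rightarrow> nat \<Rightarrow> nat \<Rightarrow> real) \<Rightarrow> (nat \<Rightarrow> nat \<Rightarrow> nat \<Rightarrow> real) \<Rightarrow> bool" where
  "dual_optimal T S A TT p P \<phi> u v \<longleftrightarrow>
     is_arg_max (\<lambda>(u, v). dual_objective T S A TT p \<phi> u v)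
       (\<lambda>(u, v). dual_feasible T S A TT p P \<phi> u v) (u, v)"

end

theory Submission imports Defs begin

text \<open>
  The two problems are a convex program and its Lagrange dual, and the claim is complementary
  slackness at a pair with no duality gap. Write \<open>x\<close> for the aggregate of \<open>y\<close>, and \<open>\<Phi>\<close>, \<open>\<Psi>\<close> for the
  integrals of \<open>\<phi>\<close> from \<open>0\<close> and of its inverse from \<open>\<phi> 0\<close>, in every coordinate \<open>(t, s, a)\<close>.

  Weak duality has two sources of slack. By conservation of mass, for any potentials \<open>v\<close> and
  prices \<open>w\<close> the linear cost \<open>\<Sum> w * x\<close> of a flow equals the value \<open>\<Sum> p * v\<close> of the incoming mass plus
  the sum of flow times reduced cost (\<open>cost_eq_value_plus_slack\<close>). And Young's inequality says
  \<open>w * x \<le> \<Phi> x + \<Psi> w\<close>, strictly unless \<open>w = \<phi> x\<close> (\<open>Young_less\<close>, \<open>Young_eq\<close>). Hence primal minus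
  dual objective is a sum of nonnegative terms, and when the gap is zero each of them vanishes
  (\<open>complementary_slackness\<close>): \<open>u = \<phi> x\<close>, and \<open>v\<close> attains its upper bound wherever \<open>y\<close> is positive.
  As dual feasibility bounds \<open>v\<close> by the cost of every other action too, the bound that is attained
  is the minimum.

  That the gap is zero follows from optimality of \<open>y\<close> (\<open>dual_dominates_primal_optimum\<close>). Freeze the
  prices at \<open>w = \<phi> x\<close>. First-order optimality says that \<open>y\<close> is a cheapest flow at these prices, so
  it costs at most as much as the flow that follows an optimal policy of the decision process with
  costs \<open>w\<close>. The latter has zero reduced cost along its path, so it costs exactly \<open>\<Sum> p * v\<close>, where
  \<open>v\<close> is the Bellman value function. Together with the equality case of Young's inequality, the
  dual objective at \<open>(w, v)\<close> is at least the primal objective at \<open>y\<close>.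
\<close>

section \<open>Young's inequality for a continuous strictly increasing function\<close>

text \<open>
  The antiderivative of \<open>f\<close> is strictly convex, so it lies strictly above its tangent at \<open>b\<close> away
  from \<open>b\<close>. Bounding the integrand by its value at an end point gives the weak inequality; applying
  this on both halves of the interval between \<open>a\<close> and \<open>b\<close> makes it strict, because \<open>f\<close> at the
  midpoint differs from \<open>f b\<close>.
\<close>

lemma integral_diff_less_tangent:
  fixes f :: "real \<Rightarrow> real"
  assumes cont: "continuous_on {0..r} f" and mono: "strict_mono_on {0..r} f"
    and a: "a \<in> {0..r}" and b: "b \<in> {0..r}" and "a \<noteq> b"
  shows "integral {0..b} f - integral {0..a} f < f b * (b - a)"
proof -
  have le: "integral {0..d} f - integral {0..c} f \<le> f d * (d - c)"
    if c: "c \<in> {0..r}" and d: "d \<in> {0..r}" for c d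
  proof (cases "c \<le> d")
    case True
    have int: "f integrable_on {0..d}" "f integrable_on {c..d}"
      using c d by (auto intro!: integrable_continuous_interval continuous_on_subset[OF cont])
    have "integral {c..d} f \<le> integral {c..d} (\<lambda>_. f d)"
      using c d int by (intro integral_le) (auto intro!: strict_mono_on_leD[OF mono])
    also have "\<dots> = f d * (d - c)" using True by simp
    finally show ?thesis
      using Henstock_Kurzweil_Integration.integral_combine[OF _ True int(1)] c by auto
  next
    case False
    then have dc: "d \<le> c" by simp
    have int: "f integrable_on {0..c}" "f integrable_on {d..c}"
      using c d by (auto intro!: integrable_continuous_interval continuous_on_subset[OF cont])
    have "f d * (c - d) = integral {d..c} (\<lambda>_. f d)" using dc by simp
    also have "\<dots> \<le> integral {d..c} f"
      using c d int by (intro integral_le) (auto intro!: strict_mono_on_leD[OF mono])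
    finally show ?thesis
      using Henstock_Kurzweil_Integration.integral_combine[OF _ dc int(1)] d
      by (auto simp: algebra_simps)
  qed
  define m where "m = (a + b) / 2"
  have m: "m \<in> {0..r}" using a b by (auto simp: m_def)
  have "(f m - f b) * (b - a) < 0"
  proof (cases "a < b")
    case True
    then have "f m < f b" by (intro strict_mono_onD[OF mono m b]) (simp add: m_def)
    with True show ?thesis by (simp add: mult_neg_pos)
  next
    case False
    with \<open>a \<noteq> b\<close> have "b < a" by simp
    then have "f b < f m" by (intro strict_mono_onD[OF mono b m]) (simp add: m_def)
    with \<open>b < a\<close> show ?thesis by (simp add: mult_pos_neg)
  qed
  moreover have "integral {0..b} f - integral {0..m} f \<le> f b * (b - m)"
    and "integral {0..m} f - integral {0..a} f \<le> f m * (m - a)"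
    using le a b m by auto
  moreover have "b - m = (b - a) / 2" "m - a = (b - a) / 2" by (auto simp: m_def field_simps)
  ultimately show ?thesis by (simp add: algebra_simps)
qed

lemma integral_diff_le_tangent:
  fixes f :: "real \<Rightarrow> real"
  assumes "continuous_on {0..r} f" "strict_mono_on {0..r} f" "a \<in> {0..r}" "b \<in> {0..r}"
  shows "integral {0..b} f - integral {0..a} f \<le> f b * (b - a)"
  using integral_diff_less_tangent[OF assms] by (cases "a = b") auto

lemma strict_mono_image_interval:
  fixes f :: "real \<Rightarrow> real"
  assumes cont: "continuous_on {0..r} f" and mono: "strict_mono_on {0..r} f" and "0 \<le> r"
  shows "f ` {0..r} = {f 0..f r}"
proof
  show "f ` {0..r} \<subseteq> {f 0..f r}"
    using \<open>0 \<le> r\<close> by (auto intro!: strict_mono_on_leD[OF mono])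
  show "{f 0..f r} \<subseteq> f ` {0..r}"
  proof
    fix w assume "w \<in> {f 0..f r}"
    then show "w \<in> f ` {0..r}" using IVT'[of f 0 w r] cont \<open>0 \<le> r\<close> by fastforce
  qed
qed

text \<open>
  The right-hand side is the convex conjugate of the antiderivative of \<open>f\<close>, with the maximizer \<open>g w\<close>
  put in. Its derivative is \<open>g\<close> (envelope theorem): the tangent inequality, used at \<open>g z\<close> and at
  \<open>g x\<close>, squeezes its difference quotient between \<open>g x\<close> and \<open>g z\<close>. Integration by
  substitution would be shorter but applies only to differentiable \<open>f\<close>.
\<close>

lemma integral_inv_into_eq_conjugate:
  fixes f :: "real \<Rightarrow> real"
  assumes cont: "continuous_on {0..r} f" and mono: "strict_mono_on {0..r} f" and "0 \<le> r"
    and w: "w \<in> {f 0..f r}"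
  defines "g \<equiv> inv_into {0..r} f"
  shows "integral {f 0..w} g = w * g w - integral {0..g w} f"
proof -
  define F where "F z = z * g z - integral {0..g z} f" for z
  have inj: "inj_on f {0..r}" by (rule strict_mono_on_imp_inj_on[OF mono])
  have img: "f ` {0..r} = {f 0..f r}" by (rule strict_mono_image_interval[OF cont mono \<open>0 \<le> r\<close>])
  have gf: "g (f x) = x" if "x \<in> {0..r}" for x
    using inv_into_f_f[OF inj that] by (simp add: g_def)
  have fg: "f (g z) = z" and gmem: "g z \<in> {0..r}" if "z \<in> {f 0..f r}" for z
    using that f_inv_into_f[of z f "{0..r}"] inv_into_into[of z f "{0..r}"]
    unfolding img g_def by auto
  have contg: "continuous_on {f 0..f r} g"
    using continuous_on_inv[OF cont compact_Icc, of g] gf unfolding img by auto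
  have der: "(F has_field_derivative g x) (at x within {f 0..f r})" if x: "x \<in> {f 0..f r}" for x
    unfolding has_field_derivative_iff
  proof -
    have lim: "((\<lambda>z. g z - g x) \<longlongrightarrow> 0) (at x within {f 0..f r})"
      using contg x by (simp add: continuous_on_def LIM_zero_iff)
    have "norm ((F z - F x) / (z - x) - g x) \<le> norm (g z - g x)"
      if z: "z \<in> {f 0..f r}" "z \<noteq> x" for z
    proof -
      let ?d = "F z - F x - (z - x) * g x"
      have "0 \<le> ?d"
        using integral_diff_le_tangent[OF cont mono gmem[OF x] gmem[OF z(1)]] fg[OF z(1)]
        by (simp add: F_def algebra_simps)
      moreover have "?d \<le> (z - x) * (g z - g x)"
        using integral_diff_le_tangent[OF cont mono gmem[OF z(1)] gmem[OF x]] fg[OF x]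
        by (simp add: F_def algebra_simps)
      ultimately have "\<bar>?d\<bar> \<le> \<bar>z - x\<bar> * \<bar>g z - g x\<bar>"
        by (simp add: abs_mult[symmetric])
      moreover have "(F z - F x) / (z - x) - g x = ?d / (z - x)"
        using z by (simp add: field_simps)
      ultimately show ?thesis using z by (simp add: field_simps)
    qed
    then have "((\<lambda>z. (F z - F x) / (z - x) - g x) \<longlongrightarrow> 0) (at x within {f 0..f r})"
      by (intro Lim_null_comparison[OF _ tendsto_norm_zero[OF lim]])
        (auto simp: eventually_at_filter)
    then show "((\<lambda>z. (F z - F x) / (z - x)) \<longlongrightarrow> g x) (at x within {f 0..f r})"
      by (simp add: LIM_zero_iff)
  qed
  have "(g has_integral F w - F (f 0)) {f 0..w}"
  proof (rule fundamental_theorem_of_calculus)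
    show "f 0 \<le> w" using w by simp
    fix x assume "x \<in> {f 0..w}"
    with w der[of x] have "(F has_field_derivative g x) (at x within {f 0..w})"
      by (auto intro: has_field_derivative_subset)
    then show "(F has_vector_derivative g x) (at x within {f 0..w})"
      by (simp add: has_real_derivative_iff_has_vector_derivative)
  qed
  moreover have "F (f 0) = 0" using gf[of 0] \<open>0 \<le> r\<close> by (simp add: F_def)
  ultimately show ?thesis by (simp add: F_def integral_unique)
qed

lemma Young_eq:
  fixes f :: "real \<Rightarrow> real"
  assumes cont: "continuous_on {0..r} f" and mono: "strict_mono_on {0..r} f"
    and x: "x \<in> {0..r}"
  shows "f x * x = integral {0..x} f + integral {f 0..f x} (inv_into {0..r} f)"
proof -
  have "f x \<in> {f 0..f r}" using x by (auto intro!: strict_mono_on_leD[OF mono])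
  then have "integral {f 0..f x} (inv_into {0..r} f) = f x * x - integral {0..x} f"
    using integral_inv_into_eq_conjugate[OF cont mono, of "f x"] x
      inv_into_f_f[OF strict_mono_on_imp_inj_on[OF mono] x] by auto
  then show ?thesis by simp
qed

text \<open>
  With \<open>w = f b\<close>, the difference of the two sides is the distance between the antiderivative of \<open>f\<close>
  at \<open>x\<close> and its tangent at \<open>b\<close>.
\<close>

lemma Young_less:
  fixes f :: "real \<Rightarrow> real"
  assumes cont: "continuous_on {0..r} f" and mono: "strict_mono_on {0..r} f"
    and x: "x \<in> {0..r}" and w: "w \<in> {f 0..f r}" and "w \<noteq> f x"
  shows "w * x < integral {0..x} f + integral {f 0..w} (inv_into {0..r} f)"
proof -
  have "0 \<le> r" using x by simp
  then obtain b where b: "b \<in> {0..r}" "w = f b"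
    using w strict_mono_image_interval[OF cont mono] by blast
  with \<open>w \<noteq> f x\<close> have "x \<noteq> b" by auto
  then show ?thesis
    using integral_diff_less_tangent[OF cont mono x b(1)] Young_eq[OF cont mono b(1)] b(2)
    by (simp add: algebra_simps)
qed

lemma Young_le:
  fixes f :: "real \<Rightarrow> real"
  assumes "continuous_on {0..r} f" "strict_mono_on {0..r} f" "x \<in> {0..r}" "w \<in> {f 0..f r}"
  shows "w * x \<le> integral {0..x} f + integral {f 0..w} (inv_into {0..r} f)"
  using Young_less[OF assms] Young_eq[OF assms(1-3)] by (cases "w = f x") auto

section \<open>Conservation of mass\<close>

text \<open>
  The expected value of the next state, or \<open>0\<close> in the last step \<open>\<tau>\<close>, so that both kinds of dual
  constraint read \<open>v \<tau> t s \<le> u t s a + continuation S P \<tau> (v \<tau>) t s a\<close>.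
\<close>

definition continuation ::
  "nat \<Rightarrow> (nat \<Rightarrow> nat \<Rightarrow> nat \<Rightarrow> real) \<Rightarrow> nat \<Rightarrow> (nat \<Rightarrow> nat \<Rightarrow> real) \<Rightarrow> nat \<Rightarrow> nat \<Rightarrow> nat \<Rightarrow> real" where
  "continuation S P \<tau> v t s a = (if t < \<tau> then \<Sum>s'=1..S. P s a s' * v (t + 1) s' else 0)"

text \<open>
  The flow equations into time \<open>n + 1\<close>, tested against \<open>c (n + 1)\<close>. Swapping the sums turns the mass
  that arrives from time \<open>n\<close> into the continuation value seen from time \<open>n\<close>.
\<close>

lemma inflow_step_eq:
  fixes c :: "nat \<Rightarrow> nat \<Rightarrow> real"
  assumes "primal_feasible S A TT p P y" "\<tau> \<in> TT" "n \<in> {1..<\<tau>}"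
  shows "(\<Sum>s=1..S. p \<tau> (n + 1) s * c (n + 1) s)
    = (\<Sum>s=1..S. \<Sum>a=1..A. y \<tau> (n + 1) s a * c (n + 1) s)
      - (\<Sum>s=1..S. \<Sum>a=1..A. y \<tau> n s a * continuation S P \<tau> c n s a)"
proof -
  have "(\<Sum>s=1..S. p \<tau> (n + 1) s * c (n + 1) s)
    = (\<Sum>s=1..S. ((\<Sum>a=1..A. y \<tau> (n + 1) s a) - (\<Sum>s'=1..S. \<Sum>a=1..A. P s' a s * y \<tau> n s' a)) * c (n + 1) s)"
    using assms by (intro sum.cong refl) (auto simp: primal_feasible_def)
  also have "\<dots> = (\<Sum>s=1..S. \<Sum>a=1..A. y \<tau> (n + 1) s a * c (n + 1) s)
     - (\<Sum>s=1..S. \<Sum>s'=1..S. \<Sum>a=1..A. P s' a s * y \<tau> n s' a * c (n + 1) s)"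
    by (simp add: left_diff_distrib sum_subtractf sum_distrib_right)
  also have "(\<Sum>s=1..S. \<Sum>s'=1..S. \<Sum>a=1..A. P s' a s * y \<tau> n s' a * c (n + 1) s)
     = (\<Sum>s'=1..S. \<Sum>s=1..S. \<Sum>a=1..A. P s' a s * y \<tau> n s' a * c (n + 1) s)"
    by (rule sum.swap)
  also have "\<dots> = (\<Sum>s'=1..S. \<Sum>a=1..A. \<Sum>s=1..S. P s' a s * y \<tau> n s' a * c (n + 1) s)"
    by (intro sum.cong refl sum.swap)
  also have "\<dots> = (\<Sum>s=1..S. \<Sum>a=1..A. y \<tau> n s a * continuation S P \<tau> c n s a)"
    using assms by (simp add: continuation_def sum_distrib_left mult_ac)
  finally show ?thesis .
qed

text \<open>
  Summation by parts in time. Cutting the sum off at \<open>n < \<tau>\<close> leaves a boundary term, the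
  continuation value of the flow at time \<open>n\<close>; the induction carries it along, and at \<open>n = \<tau>\<close> it is
  zero.
\<close>

lemma inflow_value_eq_flow_slack:
  fixes c :: "nat \<Rightarrow> nat \<Rightarrow> real"
  assumes feas: "primal_feasible S A TT p P y" and "\<tau> \<in> TT" "1 \<le> \<tau>"
  shows "(\<Sum>t=1..\<tau>. \<Sum>s=1..S. p \<tau> t s * c t s)
    = (\<Sum>t=1..\<tau>. \<Sum>s=1..S. \<Sum>a=1..A. y \<tau> t s a * (c t s - continuation S P \<tau> c t s a))"
proof -
  have "n \<le> \<tau> \<longrightarrow> (\<Sum>t=1..n. \<Sum>s=1..S. p \<tau> t s * c t s)
     - (\<Sum>s=1..S. \<Sum>a=1..A. y \<tau> n s a * continuation S P \<tau> c n s a)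
    = (\<Sum>t=1..n. \<Sum>s=1..S. \<Sum>a=1..A. y \<tau> t s a * (c t s - continuation S P \<tau> c t s a))"
    if "1 \<le> n" for n
    using that
  proof (induction n rule: nat_induct_at_least)
    case base
    have "(\<Sum>s=1..S. p \<tau> 1 s * c 1 s) = (\<Sum>s=1..S. \<Sum>a=1..A. y \<tau> 1 s a * c 1 s)"
      using feas \<open>\<tau> \<in> TT\<close>
      by (auto simp: primal_feasible_def sum_distrib_right[symmetric] intro!: sum.cong)
    then show ?case by (simp add: right_diff_distrib sum_subtractf)
  next
    case (Suc n)
    show ?case
    proof
      assume "Suc n \<le> \<tau>"
      then show "(\<Sum>t=1..Suc n. \<Sum>s=1..S. p \<tau> t s * c t s)
          - (\<Sum>s=1..S. \<Sum>a=1..A. y \<tau> (Suc n) s a * continuation S P \<tau> c (Suc n) s a)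
        = (\<Sum>t=1..Suc n. \<Sum>s=1..S. \<Sum>a=1..A. y \<tau> t s a * (c t s - continuation S P \<tau> c t s a))"
        using Suc inflow_step_eq[OF feas \<open>\<tau> \<in> TT\<close>, of n c]
        by (simp add: right_diff_distrib sum_subtractf)
    qed
  qed
  from this[of \<tau>] show ?thesis using \<open>1 \<le> \<tau>\<close> by (simp add: continuation_def)
qed

lemma sum_swap_ending_times:
  fixes h :: "nat \<Rightarrow> nat \<Rightarrow> 'a::comm_monoid_add"
  assumes "TT \<subseteq> {1..T}"
  shows "(\<Sum>t=1..T. \<Sum>\<tau>\<in>{\<tau>\<in>TT. t \<le> \<tau>}. h t \<tau>) = (\<Sum>\<tau>\<in>TT. \<Sum>t=1..\<tau>. h t \<tau>)"
proof -
  have "finite TT" using assms by (rule finite_subset) simp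
  then have "(\<Sum>t=1..T. \<Sum>\<tau>\<in>{\<tau>\<in>TT. t \<le> \<tau>}. h t \<tau>) = (\<Sum>\<tau>\<in>TT. \<Sum>t\<in>{t\<in>{1..T}. t \<le> \<tau>}. h t \<tau>)"
    by (intro sum.swap_restrict) auto
  also have "\<dots> = (\<Sum>\<tau>\<in>TT. \<Sum>t=1..\<tau>. h t \<tau>)"
    using assms by (intro sum.cong refl) fastforce
  finally show ?thesis .
qed

text \<open>
  The duality identity: for any prices \<open>w\<close> and any potentials \<open>v\<close>, the reduced costs
  \<open>w + continuation - v\<close> measure by how much the cost of a flow exceeds the value of the mass that
  enters.
\<close>

lemma cost_eq_value_plus_slack:
  assumes feas: "primal_feasible S A TT p P y" and TT: "TT \<subseteq> {1..T}"
  shows "(\<Sum>t=1..T. \<Sum>s=1..S. \<Sum>a=1..A. w t s a * aggregate TT y t s a)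
    = (\<Sum>t=1..T. \<Sum>s=1..S. \<Sum>\<tau>\<in>{\<tau>\<in>TT. t \<le> \<tau>}. p \<tau> t s * v \<tau> t s)
      + (\<Sum>\<tau>\<in>TT. \<Sum>t=1..\<tau>. \<Sum>s=1..S. \<Sum>a=1..A.
           y \<tau> t s a * (w t s a + continuation S P \<tau> (v \<tau>) t s a - v \<tau> t s))"
proof -
  have "(\<Sum>t=1..T. \<Sum>s=1..S. \<Sum>a=1..A. w t s a * aggregate TT y t s a)
     = (\<Sum>t=1..T. \<Sum>s=1..S. \<Sum>a=1..A. \<Sum>\<tau>\<in>{\<tau>\<in>TT. t \<le> \<tau>}. y \<tau> t s a * w t s a)"
    by (simp add: aggregate_def sum_distrib_left mult.commute)
  also have "\<dots> = (\<Sum>t=1..T. \<Sum>s=1..S. \<Sum>\<tau>\<in>{\<tau>\<in>TT. t \<le> \<tau>}. \<Sum>a=1..A. y \<tau> t s a * w t s a)"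
    by (intro sum.cong refl sum.swap)
  also have "\<dots> = (\<Sum>t=1..T. \<Sum>\<tau>\<in>{\<tau>\<in>TT. t \<le> \<tau>}. \<Sum>s=1..S. \<Sum>a=1..A. y \<tau> t s a * w t s a)"
    by (intro sum.cong refl sum.swap)
  also have "\<dots> = (\<Sum>\<tau>\<in>TT. \<Sum>t=1..\<tau>. \<Sum>s=1..S. \<Sum>a=1..A. y \<tau> t s a * w t s a)"
    by (rule sum_swap_ending_times[OF TT])
  finally have cost: "(\<Sum>t=1..T. \<Sum>s=1..S. \<Sum>a=1..A. w t s a * aggregate TT y t s a)
     = (\<Sum>\<tau>\<in>TT. \<Sum>t=1..\<tau>. \<Sum>s=1..S. \<Sum>a=1..A. y \<tau> t s a * w t s a)" .
  have "(\<Sum>t=1..T. \<Sum>s=1..S. \<Sum>\<tau>\<in>{\<tau>\<in>TT. t \<le> \<tau>}. p \<tau> t s * v \<tau> t s)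
     = (\<Sum>t=1..T. \<Sum>\<tau>\<in>{\<tau>\<in>TT. t \<le> \<tau>}. \<Sum>s=1..S. p \<tau> t s * v \<tau> t s)"
    by (intro sum.cong refl sum.swap)
  also have "\<dots> = (\<Sum>\<tau>\<in>TT. \<Sum>t=1..\<tau>. \<Sum>s=1..S. p \<tau> t s * v \<tau> t s)"
    by (rule sum_swap_ending_times[OF TT])
  also have "\<dots> = (\<Sum>\<tau>\<in>TT. \<Sum>t=1..\<tau>. \<Sum>s=1..S. \<Sum>a=1..A.
      y \<tau> t s a * (v \<tau> t s - continuation S P \<tau> (v \<tau>) t s a))"
    using TT by (intro sum.cong[OF refl] inflow_value_eq_flow_slack[OF feas]) auto
  finally show ?thesis unfolding cost by (simp add: sum.distrib[symmetric] algebra_simps)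
qed

text \<open>
  Transitions preserve mass, so at time \<open>n\<close> the flow with ending time \<open>\<tau>\<close> carries exactly what has
  entered up to \<open>n\<close>. Thus the aggregates stay in the interval on which \<open>\<phi>\<close> is controlled.
\<close>

lemma aggregate_in_interval:
  assumes st: "standing_assumptions T S A TT p P \<phi>" and feas: "primal_feasible S A TT p P y"
    and "t \<in> {1..T}" "s \<in> {1..S}" "a \<in> {1..A}"
  shows "aggregate TT y t s a \<in> {0..total_mass S TT p}"
proof -
  have TT: "TT \<subseteq> {1..T}" and fin: "finite TT"
    using st finite_subset[of TT "{1..T}"] by (auto simp: standing_assumptions_def)
  have y0: "0 \<le> y \<tau> t s a" if "\<tau> \<in> TT" "t \<in> {1..\<tau>}" "s \<in> {1..S}" "a \<in> {1..A}" for \<tau> t s a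
    using feas that by (auto simp: primal_feasible_def)
  have p0: "0 \<le> p \<tau> t s" if "\<tau> \<in> TT" "t \<in> {1..\<tau>}" "s \<in> {1..S}" for \<tau> t s
    using st that by (auto simp: standing_assumptions_def)
  have mass: "(\<Sum>s=1..S. \<Sum>a=1..A. y \<tau> n s a) = (\<Sum>t=1..n. \<Sum>s=1..S. p \<tau> t s)"
    if "1 \<le> n" "n \<le> \<tau>" "\<tau> \<in> TT" for n \<tau>
    using that
  proof (induction n rule: nat_induct_at_least)
    case base
    then show ?case using feas by (auto simp: primal_feasible_def)
  next
    case (Suc n)
    (* testing with the constant 1, whose continuation value is 1 as P is stochastic *)
    have "(\<Sum>s=1..S. \<Sum>a=1..A. y \<tau> n s a * continuation S P \<tau> (\<lambda>_ _. 1) n s a)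
       = (\<Sum>s=1..S. \<Sum>a=1..A. y \<tau> n s a)"
      using Suc.prems st
      by (intro sum.cong refl) (auto simp: continuation_def standing_assumptions_def)
    then show ?case
      using inflow_step_eq[OF feas \<open>\<tau> \<in> TT\<close>, of n "\<lambda>_ _. 1"] Suc by simp
  qed
  have "aggregate TT y t s a \<le> (\<Sum>\<tau>\<in>{\<tau>\<in>TT. t \<le> \<tau>}. \<Sum>t=1..\<tau>. \<Sum>s=1..S. p \<tau> t s)"
    unfolding aggregate_def
  proof (rule sum_mono)
    fix \<tau> assume "\<tau> \<in> {\<tau>\<in>TT. t \<le> \<tau>}"
    then have \<tau>: "\<tau> \<in> TT" "t \<le> \<tau>" by auto
    have "y \<tau> t s a \<le> (\<Sum>a=1..A. y \<tau> t s a)"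
      using assms \<tau> y0 by (intro member_le_sum) auto
    also have "\<dots> \<le> (\<Sum>s=1..S. \<Sum>a=1..A. y \<tau> t s a)"
      using assms \<tau> y0 by (intro member_le_sum[where f="\<lambda>s. \<Sum>a=1..A. y \<tau> t s a"] sum_nonneg) auto
    also have "\<dots> = (\<Sum>t=1..t. \<Sum>s=1..S. p \<tau> t s)"
      using mass \<tau> assms by simp
    also have "\<dots> \<le> (\<Sum>t=1..\<tau>. \<Sum>s=1..S. p \<tau> t s)"
      using \<tau> p0 by (intro sum_mono2 sum_nonneg) auto
    finally show "y \<tau> t s a \<le> (\<Sum>t=1..\<tau>. \<Sum>s=1..S. p \<tau> t s)" .
  qed
  also have "\<dots> \<le> total_mass S TT p"
    unfolding total_mass_def using fin p0 by (intro sum_mono2 sum_nonneg) auto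
  finally show ?thesis
    using y0 assms by (auto simp: aggregate_def intro!: sum_nonneg)
qed

section \<open>An optimal policy for fixed costs and the flow that follows it\<close>

text \<open>
  Backward induction becomes structural recursion when the values are indexed by the number of
  steps left before \<open>\<tau>\<close> rather than by the time.
\<close>

fun value_to_go ::
  "nat \<Rightarrow> nat \<Rightarrow> (nat \<Rightarrow> nat \<Rightarrow> nat \<Rightarrow> real) \<Rightarrow> (nat \<Rightarrow> nat \<Rightarrow> nat \<Rightarrow> real) \<Rightarrow> nat \<Rightarrow> nat \<Rightarrow> nat \<Rightarrow> real" where
  "value_to_go S A P w \<tau> 0 s = (MIN a\<in>{1..A}. w \<tau> s a)"
| "value_to_go S A P w \<tau> (Suc k) s =
    (MIN a\<in>{1..A}. w (\<tau> - Suc k) s a + (\<Sum>s'=1..S. P s a s' * value_to_go S A P w \<tau> k s'))"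

text \<open>
  The Bellman values and a greedy policy for them: every action has nonnegative reduced cost, and
  the chosen one has reduced cost zero.
\<close>

lemma Bellman_values_exist:
  fixes w :: "nat \<Rightarrow> nat \<Rightarrow> nat \<Rightarrow> real"
  assumes "1 \<le> A"
  obtains v \<pi> where
    "\<And>\<tau> t s a. t \<le> \<tau> \<Longrightarrow> a \<in> {1..A} \<Longrightarrow> v \<tau> t s \<le> w t s a + continuation S P \<tau> (v \<tau>) t s a"
    "\<And>\<tau> t s. t \<le> \<tau> \<Longrightarrow>
       v \<tau> t s = w t s (\<pi> \<tau> t s) + continuation S P \<tau> (v \<tau>) t s (\<pi> \<tau> t s)"
    "\<And>\<tau> t s. \<pi> \<tau> t s \<in> {1..A}"
proof -
  define v where "v \<tau> t s = value_to_go S A P w \<tau> (\<tau> - t) s" for \<tau> t s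
  define q where "q \<tau> t s a = w t s a + continuation S P \<tau> (v \<tau>) t s a" for \<tau> t s a
  have v_eq: "v \<tau> t s = (MIN a\<in>{1..A}. q \<tau> t s a)" if "t \<le> \<tau>" for \<tau> t s
  proof (cases "\<tau> - t")
    case 0
    with that show ?thesis by (simp add: v_def q_def continuation_def)
  next
    case (Suc k)
    then have "\<tau> - Suc k = t" "\<tau> - (t + 1) = k" "t < \<tau>" by auto
    then show ?thesis using Suc by (simp add: v_def q_def continuation_def)
  qed
  have "\<exists>a\<in>{1..A}. q \<tau> t s a = (MIN a\<in>{1..A}. q \<tau> t s a)" for \<tau> t s
    using Min_in[of "q \<tau> t s ` {1..A}"] assms by fastforce
  then obtain \<pi> where
    \<pi>: "\<pi> \<tau> t s \<in> {1..A}" "q \<tau> t s (\<pi> \<tau> t s) = (MIN a\<in>{1..A}. q \<tau> t s a)" for \<tau> t s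
    by metis
  show thesis
  proof (rule that)
    show "v \<tau> t s \<le> w t s a + continuation S P \<tau> (v \<tau>) t s a" if "t \<le> \<tau>" "a \<in> {1..A}" for \<tau> t s a
      using v_eq[OF that(1)] that(2) by (simp add: q_def[symmetric])
    show "v \<tau> t s = w t s (\<pi> \<tau> t s) + continuation S P \<tau> (v \<tau>) t s (\<pi> \<tau> t s)" if "t \<le> \<tau>" for \<tau> t s
      using v_eq[OF that] \<pi>(2) by (simp add: q_def[symmetric])
  qed (rule \<pi>(1))
qed

text \<open>
  The mass in each state under the policy \<open>\<pi>\<close> with inflow \<open>q\<close>. Time \<open>0\<close> precedes the process and
  is empty, which lets the first real step obey the same recursion as all others.
\<close>

fun policy_mass ::
  "nat \<Rightarrow> (nat \<Rightarrow> nat \<Rightarrow> nat \<Rightarrow> real) \<Rightarrow> (nat \<Rightarrow> nat \<Rightarrow> real) \<Rightarrow> (nat \<Rightarrow> nat \<Rightarrow> nat) \<Rightarrow> nat \<Rightarrow> nat \<Rightarrow> real" where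
  "policy_mass S P q \<pi> 0 s = 0"
| "policy_mass S P q \<pi> (Suc t) s =
    q (Suc t) s + (\<Sum>s'=1..S. P s' (\<pi> t s') s * policy_mass S P q \<pi> t s')"

lemma policy_mass_nonneg:
  assumes "\<And>s a s'. s \<in> {1..S} \<Longrightarrow> a \<in> {1..A} \<Longrightarrow> s' \<in> {1..S} \<Longrightarrow> 0 \<le> P s a s'"
    and "\<And>t s. t \<in> {1..\<tau>} \<Longrightarrow> s \<in> {1..S} \<Longrightarrow> 0 \<le> q t s" and "\<And>t s. \<pi> t s \<in> {1..A}"
    and "t \<le> \<tau>" "s \<in> {1..S}"
  shows "0 \<le> policy_mass S P q \<pi> t s"
  using assms(4,5)
proof (induction t arbitrary: s)
  case (Suc t)
  then show ?case using assms(1-3)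
    by (auto intro!: add_nonneg_nonneg sum_nonneg mult_nonneg_nonneg)
qed simp

lemma policy_flow_feasible:
  assumes st: "standing_assumptions T S A TT p P \<phi>" and \<pi>: "\<And>\<tau> t s. \<pi> \<tau> t s \<in> {1..A}"
  shows "primal_feasible S A TT p P
    (\<lambda>\<tau> t s a. if a = \<pi> \<tau> t s then policy_mass S P (p \<tau>) (\<pi> \<tau>) t s else 0)"
proof -
  have "0 \<le> policy_mass S P (p \<tau>) (\<pi> \<tau>) t s" if "\<tau> \<in> TT" "t \<in> {1..\<tau>}" "s \<in> {1..S}" for \<tau> t s
    using st that \<pi>
    by (intro policy_mass_nonneg[where \<tau>=\<tau> and A=A]) (auto simp: standing_assumptions_def)
  then show ?thesis using \<pi>
    by (auto simp: primal_feasible_def if_distrib[of "\<lambda>x. _ * x"] cong: if_cong)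
qed

section \<open>First-order optimality\<close>

lemma primal_feasible_convex:
  assumes y: "primal_feasible S A TT p P y" and z: "primal_feasible S A TT p P z"
    and e: "0 \<le> e" "e \<le> 1"
  shows "primal_feasible S A TT p P (\<lambda>\<tau> t s a. (1 - e) * y \<tau> t s a + e * z \<tau> t s a)"
proof -
  have comb: "c = (1 - e) * c + e * c" for c :: real by (simp add: algebra_simps)
  show ?thesis
    unfolding primal_feasible_def
  proof (intro ballI conjI)
    fix \<tau> s assume \<tau>: "\<tau> \<in> TT" "s \<in> {1..S}"
    show "(\<Sum>a=1..A. (1 - e) * y \<tau> 1 s a + e * z \<tau> 1 s a) = p \<tau> 1 s"
      using y z \<tau> comb[of "p \<tau> 1 s"]
      by (simp add: primal_feasible_def sum.distrib sum_distrib_left[symmetric])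
    fix t
    show "0 \<le> (1 - e) * y \<tau> t s a + e * z \<tau> t s a" if "t \<in> {1..\<tau>}" "a \<in> {1..A}" for a
      using y z \<tau> that e by (auto simp: primal_feasible_def)
    assume t: "t \<in> {1..<\<tau>}"
    let ?in = "\<lambda>x. \<Sum>s'=1..S. \<Sum>a=1..A. P s' a s * x \<tau> t s' a"
    have "(\<Sum>a=1..A. (1 - e) * y \<tau> (t + 1) s a + e * z \<tau> (t + 1) s a)
       = (1 - e) * (p \<tau> (t + 1) s + ?in y) + e * (p \<tau> (t + 1) s + ?in z)"
      using y z \<tau> t by (simp add: primal_feasible_def sum.distrib sum_distrib_left[symmetric])
    also have "\<dots> = p \<tau> (t + 1) s + ((1 - e) * ?in y + e * ?in z)"
      by (simp add: algebra_simps)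
    also have "(1 - e) * ?in y + e * ?in z = ?in (\<lambda>\<tau> t s a. (1 - e) * y \<tau> t s a + e * z \<tau> t s a)"
      by (simp add: sum.distrib sum_distrib_left ring_distribs mult_ac)
    finally show "(\<Sum>a=1..A. (1 - e) * y \<tau> (t + 1) s a + e * z \<tau> (t + 1) s a) = p \<tau> (t + 1) s
       + (\<Sum>s'=1..S. \<Sum>a=1..A. P s' a s * ((1 - e) * y \<tau> t s' a + e * z \<tau> t s' a))" .
  qed
qed

text \<open>
  A minimizer of the convex objective also minimizes the linear cost whose prices are the
  gradient at the minimizer. Moving from \<open>y\<close> a fraction \<open>e\<close> of the way to \<open>z\<close> cannot decrease the
  objective, while by the tangent inequality it increases it by at most \<open>e\<close> times the cost difference
  at the prices of the new point. Dividing by \<open>e\<close> and letting \<open>e\<close> tend to \<open>0\<close>, these prices converge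
  to those of \<open>y\<close>.
\<close>

lemma first_order_optimality:
  assumes st: "standing_assumptions T S A TT p P \<phi>" and opt: "primal_optimal T S A TT p P \<phi> y"
    and z: "primal_feasible S A TT p P z"
  shows "(\<Sum>t=1..T. \<Sum>s=1..S. \<Sum>a=1..A. \<phi> t s a (aggregate TT y t s a) * aggregate TT y t s a)
    \<le> (\<Sum>t=1..T. \<Sum>s=1..S. \<Sum>a=1..A. \<phi> t s a (aggregate TT y t s a) * aggregate TT z t s a)"
proof -
  let ?\<rho> = "total_mass S TT p"
  have y: "primal_feasible S A TT p P y"
    and min: "\<And>x. primal_feasible S A TT p P x \<Longrightarrow>
      primal_objective T S A TT \<phi> y \<le> primal_objective T S A TT \<phi> x"
    using opt by (auto simp: primal_optimal_def is_arg_min_def not_less)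
  define x where "x e = (\<lambda>\<tau> t s a. (1 - e) * y \<tau> t s a + e * z \<tau> t s a)" for e :: real
  define d where "d t s a = aggregate TT z t s a - aggregate TT y t s a" for t s a
  have x: "primal_feasible S A TT p P (x e)" if "0 \<le> e" "e \<le> 1" for e
    unfolding x_def using primal_feasible_convex[OF y z that] .
  have agg: "aggregate TT (x e) t s a = aggregate TT y t s a + e * d t s a" for e t s a
    by (simp add: aggregate_def x_def d_def sum.distrib left_diff_distrib right_diff_distrib
        sum_subtractf sum_distrib_left)
  (* the cost difference between z and y at the prices of the intermediate point x e *)
  define G where "G e = (\<Sum>t=1..T. \<Sum>s=1..S. \<Sum>a=1..A. \<phi> t s a (aggregate TT (x e) t s a) * d t s a)" for e
  have G_nonneg: "0 \<le> G e" if e: "0 < e" "e \<le> 1" for e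
  proof -
    have "primal_objective T S A TT \<phi> (x e) - primal_objective T S A TT \<phi> y
      = (\<Sum>t=1..T. \<Sum>s=1..S. \<Sum>a=1..A. integral {0..aggregate TT (x e) t s a} (\<phi> t s a)
           - integral {0..aggregate TT y t s a} (\<phi> t s a))"
      by (simp add: primal_objective_def sum_subtractf)
    also have "\<dots> \<le> (\<Sum>t=1..T. \<Sum>s=1..S. \<Sum>a=1..A. \<phi> t s a (aggregate TT (x e) t s a)
           * (aggregate TT (x e) t s a - aggregate TT y t s a))"
      using st aggregate_in_interval[OF st y] aggregate_in_interval[OF st x] e
      by (intro sum_mono integral_diff_le_tangent[where r = ?\<rho>])
        (auto simp: standing_assumptions_def)
    also have "\<dots> = e * G e"
      by (simp add: agg G_def sum_distrib_left mult_ac)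
    finally have "0 \<le> e * G e" using min[OF x[of e]] e by simp
    then show ?thesis using e by (simp add: zero_le_mult_iff)
  qed
  have "(G \<longlongrightarrow> G 0) (at_right 0)"
    unfolding G_def
  proof (intro tendsto_sum tendsto_mult tendsto_const)
    fix t s a assume i: "t \<in> {1..T}" "s \<in> {1..S}" "a \<in> {1..A}"
    have "continuous_on {0..1} (\<lambda>e. \<phi> t s a (aggregate TT (x e) t s a))"
    proof (rule continuous_on_compose2[where g = "\<phi> t s a"])
      show "continuous_on {0..?\<rho>} (\<phi> t s a)" using st i by (auto simp: standing_assumptions_def)
      show "continuous_on {0..1} (\<lambda>e. aggregate TT (x e) t s a)"
        unfolding agg by (intro continuous_intros)
      show "(\<lambda>e. aggregate TT (x e) t s a) ` {0..1} \<subseteq> {0..?\<rho>}"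
        using aggregate_in_interval[OF st x i] by auto
    qed
    then have "((\<lambda>e. \<phi> t s a (aggregate TT (x e) t s a)) \<longlongrightarrow> \<phi> t s a (aggregate TT (x 0) t s a))
        (at 0 within {0..1})"
      by (simp add: continuous_on_def)
    then show "((\<lambda>e. \<phi> t s a (aggregate TT (x e) t s a)) \<longlongrightarrow> \<phi> t s a (aggregate TT (x 0) t s a))
        (at_right 0)"
      by (simp add: at_within_Icc_at_right)
  qed
  moreover have "eventually (\<lambda>e. 0 \<le> G e) (at_right 0)"
    using eventually_at_right_less[of 0] eventually_at_right_real[of 0 "1::real"]
    by (auto elim!: eventually_mono intro: G_nonneg)
  ultimately have "0 \<le> G 0"
    by (rule tendsto_lowerbound) simp
  then show ?thesis by (simp add: G_def agg d_def right_diff_distrib sum_subtractf)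
qed

section \<open>Strong duality and complementary slackness\<close>

lemma sum_triple_nonneg_eq_0:
  fixes h :: "nat \<Rightarrow> nat \<Rightarrow> nat \<Rightarrow> real"
  assumes nonneg: "\<And>t s a. t \<in> {1..T} \<Longrightarrow> s \<in> {1..S} \<Longrightarrow> a \<in> {1..A} \<Longrightarrow> 0 \<le> h t s a"
    and zero: "(\<Sum>t=1..T. \<Sum>s=1..S. \<Sum>a=1..A. h t s a) = 0"
    and i: "t \<in> {1..T}" "s \<in> {1..S}" "a \<in> {1..A}"
  shows "h t s a = 0"
proof -
  have "(\<Sum>s=1..S. \<Sum>a=1..A. h t s a) = 0"
    using zero i nonneg
    by (subst (asm) sum_nonneg_eq_0_iff) (auto intro!: sum_nonneg)
  then have "(\<Sum>a=1..A. h t s a) = 0"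
    using i nonneg by (subst (asm) sum_nonneg_eq_0_iff) (auto intro!: sum_nonneg)
  then show ?thesis
    using i nonneg by (subst (asm) sum_nonneg_eq_0_iff) auto
qed

text \<open>
  Strong duality. The witnesses are the prices \<open>\<phi> x\<close> at the aggregates \<open>x\<close> of \<open>y\<close> and the Bellman
  values for these prices; the greedy flow \<open>z\<close> costs exactly
  the value of the incoming mass, so the flow \<open>y\<close>, a cheapest one at these prices, costs no more.
\<close>

lemma dual_dominates_primal_optimum:
  assumes st: "standing_assumptions T S A TT p P \<phi>" and opt: "primal_optimal T S A TT p P \<phi> y"
  obtains u v where "dual_feasible T S A TT p P \<phi> u v"
    "primal_objective T S A TT \<phi> y \<le> dual_objective T S A TT p \<phi> u v"
proof -
  let ?\<rho> = "total_mass S TT p"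
  have TT: "TT \<subseteq> {1..T}" and A: "1 \<le> A"
    and \<phi>: "\<And>t s a. t \<in> {1..T} \<Longrightarrow> s \<in> {1..S} \<Longrightarrow> a \<in> {1..A} \<Longrightarrow>
      continuous_on {0..?\<rho>} (\<phi> t s a) \<and> strict_mono_on {0..?\<rho>} (\<phi> t s a)"
    using st by (auto simp: standing_assumptions_def)
  have y: "primal_feasible S A TT p P y"
    using opt by (auto simp: primal_optimal_def is_arg_min_def)
  note x_mem = aggregate_in_interval[OF st y]
  define w where "w t s a = \<phi> t s a (aggregate TT y t s a)" for t s a
  obtain v \<pi> where
    v_le: "\<And>\<tau> t s a. t \<le> \<tau> \<Longrightarrow> a \<in> {1..A} \<Longrightarrow> v \<tau> t s \<le> w t s a + continuation S P \<tau> (v \<tau>) t s a"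
    and v_eq: "\<And>\<tau> t s. t \<le> \<tau> \<Longrightarrow>
       v \<tau> t s = w t s (\<pi> \<tau> t s) + continuation S P \<tau> (v \<tau>) t s (\<pi> \<tau> t s)"
    and \<pi>: "\<And>\<tau> t s. \<pi> \<tau> t s \<in> {1..A}"
    using Bellman_values_exist[OF A] by metis
  define z where
    "z = (\<lambda>\<tau> t s a. if a = \<pi> \<tau> t s then policy_mass S P (p \<tau>) (\<pi> \<tau>) t s else 0)"
  have z: "primal_feasible S A TT p P z"
    unfolding z_def by (rule policy_flow_feasible[OF st \<pi>])
  have slack: "z \<tau> t s a * (w t s a + continuation S P \<tau> (v \<tau>) t s a - v \<tau> t s) = 0" if "t \<le> \<tau>" for \<tau> t s a
    using v_eq[OF that] by (simp add: z_def)
  have cost_z: "(\<Sum>t=1..T. \<Sum>s=1..S. \<Sum>a=1..A. w t s a * aggregate TT z t s a)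
     = (\<Sum>t=1..T. \<Sum>s=1..S. \<Sum>\<tau>\<in>{\<tau>\<in>TT. t \<le> \<tau>}. p \<tau> t s * v \<tau> t s)"
    unfolding cost_eq_value_plus_slack[OF z TT, of w v] by (simp add: slack)
  have "primal_objective T S A TT \<phi> y
     = (\<Sum>t=1..T. \<Sum>s=1..S. \<Sum>a=1..A. w t s a * aggregate TT y t s a
         - integral {\<phi> t s a 0..w t s a} (inv_into {0..?\<rho>} (\<phi> t s a)))"
    unfolding primal_objective_def w_def
    using \<phi> x_mem by (intro sum.cong refl) (simp add: Young_eq[where r = ?\<rho>])
  also have "\<dots> \<le> dual_objective T S A TT p \<phi> w v"
    using first_order_optimality[OF st opt z]
    unfolding dual_objective_def cost_z[symmetric] by (simp add: sum_subtractf w_def)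
  finally have le: "primal_objective T S A TT \<phi> y \<le> dual_objective T S A TT p \<phi> w v" .
  have "w t s a \<in> {\<phi> t s a 0..\<phi> t s a ?\<rho>}" if i: "t \<in> {1..T}" "s \<in> {1..S}" "a \<in> {1..A}" for t s a
    using x_mem[OF i] \<phi>[OF i] by (auto simp: w_def intro!: strict_mono_on_leD[of "{0..?\<rho>}" "\<phi> t s a"])
  moreover have "v \<tau> \<tau> s \<le> w \<tau> s a" if "a \<in> {1..A}" for \<tau> s a
    using v_le[of \<tau> \<tau> a s] that by (simp add: continuation_def)
  moreover have "v \<tau> t s \<le> w t s a + (\<Sum>s'=1..S. P s a s' * v \<tau> (t + 1) s')"
    if "a \<in> {1..A}" "t \<in> {1..<\<tau>}" for \<tau> t s a
    using v_le[of t \<tau> a s] that by (simp add: continuation_def)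
  ultimately have "dual_feasible T S A TT p P \<phi> w v"
    unfolding dual_feasible_def by blast
  then show thesis using le that by blast
qed

text \<open>
  The duality gap is the sum of all Young defects and of all products of flow and reduced cost.
  These are nonnegative, so without a gap all of them are zero.
\<close>

lemma complementary_slackness:
  assumes st: "standing_assumptions T S A TT p P \<phi>"
    and y: "primal_feasible S A TT p P y" and uv: "dual_feasible T S A TT p P \<phi> u v"
    and gap: "primal_objective T S A TT \<phi> y \<le> dual_objective T S A TT p \<phi> u v"
  shows "\<And>t s a. t \<in> {1..T} \<Longrightarrow> s \<in> {1..S} \<Longrightarrow> a \<in> {1..A} \<Longrightarrow>
      u t s a = \<phi> t s a (aggregate TT y t s a)"
    and "\<And>\<tau> t s a. \<tau> \<in> TT \<Longrightarrow> t \<in> {1..\<tau>} \<Longrightarrow> s \<in> {1..S} \<Longrightarrow> a \<in> {1..A} \<Longrightarrow> 0 < y \<tau> t s a \<Longrightarrow>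
      v \<tau> t s = u t s a + continuation S P \<tau> (v \<tau>) t s a"
proof -
  let ?\<rho> = "total_mass S TT p"
  have TT: "TT \<subseteq> {1..T}" and finTT: "finite TT"
    and \<phi>: "\<And>t s a. t \<in> {1..T} \<Longrightarrow> s \<in> {1..S} \<Longrightarrow> a \<in> {1..A} \<Longrightarrow>
      continuous_on {0..?\<rho>} (\<phi> t s a) \<and> strict_mono_on {0..?\<rho>} (\<phi> t s a)"
    using st finite_subset[of TT "{1..T}"] by (auto simp: standing_assumptions_def)
  note x_mem = aggregate_in_interval[OF st y]
  have u_mem: "u t s a \<in> {\<phi> t s a 0..\<phi> t s a ?\<rho>}"
    if "t \<in> {1..T}" "s \<in> {1..S}" "a \<in> {1..A}" for t s a
    using uv that by (auto simp: dual_feasible_def)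
  define slack where "slack \<tau> t s a = y \<tau> t s a * (u t s a + continuation S P \<tau> (v \<tau>) t s a - v \<tau> t s)"
    for \<tau> t s a
  define young where "young t s a = integral {0..aggregate TT y t s a} (\<phi> t s a)
     + integral {\<phi> t s a 0..u t s a} (inv_into {0..?\<rho>} (\<phi> t s a)) - u t s a * aggregate TT y t s a"
    for t s a
  have young_nonneg: "0 \<le> young t s a" if i: "t \<in> {1..T}" "s \<in> {1..S}" "a \<in> {1..A}" for t s a
    using Young_le[OF _ _ x_mem[OF i] u_mem[OF i]] \<phi>[OF i] by (simp add: young_def)
  have slack_nonneg: "0 \<le> slack \<tau> t s a"
    if i: "\<tau> \<in> TT" "t \<in> {1..\<tau>}" "s \<in> {1..S}" "a \<in> {1..A}" for \<tau> t s a
  proof -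
    have "0 \<le> y \<tau> t s a" using y i by (auto simp: primal_feasible_def)
    moreover have "v \<tau> t s \<le> u t s a + continuation S P \<tau> (v \<tau>) t s a"
      using uv i by (cases "t = \<tau>") (auto simp: dual_feasible_def continuation_def)
    ultimately show ?thesis by (simp add: slack_def)
  qed
  have "primal_objective T S A TT \<phi> y - dual_objective T S A TT p \<phi> u v
     = (\<Sum>t=1..T. \<Sum>s=1..S. \<Sum>a=1..A. young t s a)
       + (\<Sum>\<tau>\<in>TT. \<Sum>t=1..\<tau>. \<Sum>s=1..S. \<Sum>a=1..A. slack \<tau> t s a)"
    using cost_eq_value_plus_slack[OF y TT, of u v]
    by (simp add: primal_objective_def dual_objective_def young_def slack_def sum.distrib sum_subtractf)
  moreover have "0 \<le> (\<Sum>t=1..T. \<Sum>s=1..S. \<Sum>a=1..A. young t s a)"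
    by (intro sum_nonneg young_nonneg)
  moreover have "0 \<le> (\<Sum>\<tau>\<in>TT. \<Sum>t=1..\<tau>. \<Sum>s=1..S. \<Sum>a=1..A. slack \<tau> t s a)"
    by (intro sum_nonneg slack_nonneg)
  ultimately have young0: "(\<Sum>t=1..T. \<Sum>s=1..S. \<Sum>a=1..A. young t s a) = 0"
    and slack0: "(\<Sum>\<tau>\<in>TT. \<Sum>t=1..\<tau>. \<Sum>s=1..S. \<Sum>a=1..A. slack \<tau> t s a) = 0"
    using gap by linarith+
  show "u t s a = \<phi> t s a (aggregate TT y t s a)" if i: "t \<in> {1..T}" "s \<in> {1..S}" "a \<in> {1..A}" for t s a
  proof (rule ccontr)
    assume "u t s a \<noteq> \<phi> t s a (aggregate TT y t s a)"
    then have "0 < young t s a"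
      using Young_less[OF _ _ x_mem[OF i] u_mem[OF i]] \<phi>[OF i] by (simp add: young_def)
    moreover have "young t s a = 0"
      by (rule sum_triple_nonneg_eq_0[OF young_nonneg young0 i])
    ultimately show False by simp
  qed
  show "v \<tau> t s = u t s a + continuation S P \<tau> (v \<tau>) t s a"
    if \<tau>: "\<tau> \<in> TT" and i: "t \<in> {1..\<tau>}" "s \<in> {1..S}" "a \<in> {1..A}" and pos: "0 < y \<tau> t s a" for \<tau> t s a
  proof -
    have "(\<Sum>t=1..\<tau>. \<Sum>s=1..S. \<Sum>a=1..A. slack \<tau> t s a) = 0"
      using slack0 \<tau> slack_nonneg finTT
      by (subst (asm) sum_nonneg_eq_0_iff) (auto intro!: sum_nonneg)
    from sum_triple_nonneg_eq_0[OF slack_nonneg[OF \<tau>] this i] have "slack \<tau> t s a = 0" .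
    with pos show ?thesis by (simp add: slack_def)
  qed
qed

theorem theorem2:
  fixes T S A :: nat
    and TT :: "nat set"
    and p :: "nat \<Rightarrow> nat \<Rightarrow> nat \<Rightarrow> real"
    and P :: "nat \<Rightarrow> nat \<Rightarrow> nat \<Rightarrow> real"
    and \<phi> :: "nat \<Rightarrow> nat \<Rightarrow> nat \<Rightarrow> real \<Rightarrow> real"
    and y :: "nat \<Rightarrow> nat \<Rightarrow> nat \<Rightarrow> nat \<Rightarrow> real"
    and u :: "nat \<Rightarrow> nat \<Rightarrow> nat \<Rightarrow> real"
    and v :: "nat \<Rightarrow> nat \<Rightarrow> nat \<Rightarrow> real"
  assumes "standing_assumptions T S A TT p P \<phi>"
    and "primal_optimal T S A TT p P \<phi> y"
    and "dual_optimal T S A TT p P \<phi> u v"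
  shows "\<forall>\<tau>\<in>TT. \<forall>s\<in>{1..S}. \<forall>a\<in>{1..A}.
    (y \<tau> \<tau> s a > 0 \<longrightarrow>
       v \<tau> \<tau> s = (MIN a'\<in>{1..A}. \<phi> \<tau> s a' (aggregate TT y \<tau> s a')) \<and>
       \<phi> \<tau> s a (aggregate TT y \<tau> s a) = (MIN a'\<in>{1..A}. \<phi> \<tau> s a' (aggregate TT y \<tau> s a'))) \<and>
    (\<forall>t\<in>{1..<\<tau>}. y \<tau> t s a > 0 \<longrightarrow>
       v \<tau> t s = (MIN a'\<in>{1..A}. \<phi> t s a' (aggregate TT y t s a')
                      + (\<Sum>s'=1..S. P s a' s' * v \<tau> (t + 1) s')) \<and>
       \<phi> t s a (aggregate TT y t s a) + (\<Sum>s'=1..S. P s a s' * v \<tau> (t + 1) s')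
         = (MIN a'\<in>{1..A}. \<phi> t s a' (aggregate TT y t s a')
                      + (\<Sum>s'=1..S. P s a' s' * v \<tau> (t + 1) s')))"
proof -
  have TT: "TT \<subseteq> {1..T}" using assms(1) by (auto simp: standing_assumptions_def)
  have y: "primal_feasible S A TT p P y"
    using assms(2) by (auto simp: primal_optimal_def is_arg_min_def)
  have uv: "dual_feasible T S A TT p P \<phi> u v"
    and max: "\<And>u' v'. dual_feasible T S A TT p P \<phi> u' v' \<Longrightarrow>
      dual_objective T S A TT p \<phi> u' v' \<le> dual_objective T S A TT p \<phi> u v"
    using assms(3) by (auto simp: dual_optimal_def is_arg_max_def not_less)
  have gap: "primal_objective T S A TT \<phi> y \<le> dual_objective T S A TT p \<phi> u v"
    by (rule dual_dominates_primal_optimum[OF assms(1,2)]) (rule order_trans[OF _ max])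
  note cs = complementary_slackness[OF assms(1) y uv gap]
  have argmin: "c = (MIN a'\<in>{1..A}. h a') \<and> h a = (MIN a'\<in>{1..A}. h a')"
    if "a \<in> {1..A}" "c = h a" "\<And>a'. a' \<in> {1..A} \<Longrightarrow> c \<le> h a'" for a c and h :: "nat \<Rightarrow> real"
  proof -
    have "(MIN a'\<in>{1..A}. h a') = h a" using that by (intro Min_eqI) auto
    with that show ?thesis by simp
  qed
  show ?thesis
  proof (intro ballI)
    fix \<tau> s a assume i: "\<tau> \<in> TT" "s \<in> {1..S}" "a \<in> {1..A}"
    have u: "\<phi> t s a' (aggregate TT y t s a') = u t s a'" if "t \<in> {1..\<tau>}" "a' \<in> {1..A}" for t a'
      using cs(1)[of t s a'] TT i that by fastforce
    have "v \<tau> \<tau> s = (MIN a'\<in>{1..A}. \<phi> \<tau> s a' (aggregate TT y \<tau> s a')) \<and>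
       \<phi> \<tau> s a (aggregate TT y \<tau> s a) = (MIN a'\<in>{1..A}. \<phi> \<tau> s a' (aggregate TT y \<tau> s a'))"
      if pos: "y \<tau> \<tau> s a > 0"
    proof (rule argmin)
      have \<tau>: "\<tau> \<in> {1..\<tau>}" using TT i by auto
      show "v \<tau> \<tau> s = \<phi> \<tau> s a (aggregate TT y \<tau> s a)"
        using cs(2)[OF i(1) \<tau> i(2,3) pos] u[OF \<tau> i(3)] by (simp add: continuation_def)
      show "v \<tau> \<tau> s \<le> \<phi> \<tau> s a' (aggregate TT y \<tau> s a')" if "a' \<in> {1..A}" for a'
        using uv i u[OF \<tau> that] that by (auto simp: dual_feasible_def)
    qed (rule i)
    moreover have "v \<tau> t s = (MIN a'\<in>{1..A}. \<phi> t s a' (aggregate TT y t s a')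
                      + (\<Sum>s'=1..S. P s a' s' * v \<tau> (t + 1) s')) \<and>
       \<phi> t s a (aggregate TT y t s a) + (\<Sum>s'=1..S. P s a s' * v \<tau> (t + 1) s')
         = (MIN a'\<in>{1..A}. \<phi> t s a' (aggregate TT y t s a')
                      + (\<Sum>s'=1..S. P s a' s' * v \<tau> (t + 1) s'))"
      if t: "t \<in> {1..<\<tau>}" and pos: "y \<tau> t s a > 0" for t
    proof (rule argmin)
      have t': "t \<in> {1..\<tau>}" using t by auto
      show "v \<tau> t s = \<phi> t s a (aggregate TT y t s a) + (\<Sum>s'=1..S. P s a s' * v \<tau> (t + 1) s')"
        using cs(2)[OF i(1) t' i(2,3) pos] u[OF t' i(3)] t by (simp add: continuation_def)
      show "v \<tau> t s \<le> \<phi> t s a' (aggregate TT y t s a') + (\<Sum>s'=1..S. P s a' s' * v \<tau> (t + 1) s')"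
        if "a' \<in> {1..A}" for a'
        using uv i t u[OF t' that] that by (auto simp: dual_feasible_def)
    qed (rule i)
    ultimately show "(y \<tau> \<tau> s a > 0 \<longrightarrow>
       v \<tau> \<tau> s = (MIN a'\<in>{1..A}. \<phi> \<tau> s a' (aggregate TT y \<tau> s a')) \<and>
       \<phi> \<tau> s a (aggregate TT y \<tau> s a) = (MIN a'\<in>{1..A}. \<phi> \<tau> s a' (aggregate TT y \<tau> s a'))) \<and>
    (\<forall>t\<in>{1..<\<tau>}. y \<tau> t s a > 0 \<longrightarrow>
       v \<tau> t s = (MIN a'\<in>{1..A}. \<phi> t s a' (aggregate TT y t s a')
                      + (\<Sum>s'=1..S. P s a' s' * v \<tau> (t + 1) s')) \<and>
       \<phi> t s a (aggregate TT y t s a) + (\<Sum>s'=1..S. P s a s' * v \<tau> (t + 1) s')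
         = (MIN a'\<in>{1..A}. \<phi> t s a' (aggregate TT y t s a')
                      + (\<Sum>s'=1..S. P s a' s' * v \<tau> (t + 1) s')))"
      by blast
  qed
qed

end
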